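(* Let $D=\mathbb{R}\times(0,+\infty)$ and let $N\subset D$ be a manifold. Let $\overline A=(A_1\ A_2\ A_3)$, $\overline A(f,g,h)=A_1f+A_2g+A_3h$, be the (generalized) solution operator of the Cauchy problem for the one-dimensional wave equation $x_{tt}-x_{uu}=f$ in $D$, $x(u,0)=g(u)$, $x_t(u,0)=h(u)$, $u\in\mathbb{R}$, given by the d'Alembert formula: for $(u,t)\in N$, $$(A_1f)(u,t)=\frac12\int_0^t\!\int_{u-s}^{u+s}f(v,t-s)\,d\mu(v)\,d\mu(s),\quad(A_2g)(u,t)=\frac{g(u-t)+g(u+t)}2,\quad(A_3h)(u,t)=\frac12\int_{u-t}^{u+t}h(v)\,d\mu(v).$$ Let $M_1\subset D$ and $M_2,M_3\subset\mathbb{R}$ be compact sets and, for $i=1,2,3$, let $\omega_i$ be a modulus of continuity, $W_i=H^{\omega_i}_\mu(M_i)$, $Q_i$ a set of $n_i\in\mathbb{N}$ points of $M_i$, $e_i\in\mathbb{R}^{n_i}_+$, $I_i=I_{Q_i}$, $U_i=U_{e_i}$, $L_i=L_{\omega_i,Q_i,e_i}$, $\tau_i=\tau_{\omega_i,Q_i,e_i}$; put $\overline W=W_1\times W_2\times W_3$, $\overline I=\mathrm{diag}(I_1,I_2,I_3)$, $\overline U=U_1\times U_2\times U_3$. Let $Y\subset\mathfrak{M}(N,\mu)$ be a normed lattice containing the essentially bounded and integrable functions on $N$, and such that $A_i(B_\mu(M_i))\subset Y$, $i=1,2,3$. Then $\Phi=\overline A\,\overline L$, $\overline L=\mathrm{diag}(L_1,L_2,L_3)$,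 is an optimal method of recovery of the operator $\overline A$ on the class $\overline W$ based on information $\overline I$ with $\overline U$-error, and $$\mathcal{E}(\overline A;\overline W;\overline I;\overline U)=\mathcal{E}(\overline A;\overline W;\overline I;\overline U;\Phi)=\|\overline A\,\overline\tau\|_Y,\qquad\overline\tau=\tau_1\times\tau_2\times\tau_3,\quad\overline A\,\overline\tau=A_1\tau_1+A_2\tau_2+A_3\tau_3.$$
   Context: $\mu$ denotes Lebesgue measure of the dimension of the set or manifold on which it is considered. $D$ and $\mathbb{R}$ carry the Euclidean metric. Here $B_\mu(M_i)$ is the set of bounded Borel functions on the ambient space ($D$ for $i=1$, $\mathbb{R}$ for $i=2,3$) vanishing outside $M_i$, and the operators $A_i$ act on it by the pointwise formulas above. $\mathbb{R}_+=[0,\infty)$. A modulus of continuity is a continuous non-decreasing $\omega:\mathbb{R}_+\to\mathbb{R}_+$ with $\omega(0)=0$ and $\omega(t'+t'')\le\omega(t')+\omega(t'')$. For $M=D$ or $M=\mathbb{R}$ with Euclidean metric $\rho$ and compact $M'\subset M$: $H^\omega_\mu(M')$ is the set of functions $x=y\cdot\chi_{M'}$, $y:M\to\mathbb{R}$ continuous, with $|x(t')-x(t'')|\le\omega(\rho(t',t''))$ for all $t',t''\in M'$. For $Q=\{q_1,\dots,q_n\}\subset M'$ and $e=(e^1,\dots,e^n)\in\mathbb{R}^n_+$: $I_Qx=(x(q_1),\dots,x(q_n))$; $U_e=[-e^1,e^1]\times\dots\times[-e^n,e^n]$; $\tau_{\omega,Q,e}(t)=\min_{1\le j\le n}(e^j+\omega(\rho(t,q_j)))$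 for $t\in M'$ and $0$ on $M\setminus M'$; $\Pi'_j=\{t\in M':\tau_{\omega,Q,e}(t)=e^j+\omega(\rho(t,q_j))\}$, $\Pi_1=\Pi'_1$, $\Pi_j=\Pi'_j\setminus\bigcup_{s<j}\Pi_s$; $L_{\omega,Q,e}z(t)=z_j$ for $t\in\Pi_j$ and $0$ on $M\setminus M'$, $z\in\mathbb{R}^n$. $\mathfrak{M}(N,\mu)$ is the space of measurable a.e. finite functions on $N$ modulo a.e. equality, ordered by $x'\prec x''$ iff $x'\le x''$ a.e. A normed lattice $Y\subset\mathfrak{M}(N,\mu)$ is a normed space which is a vector lattice for the inherited order with $|x|\prec|y|\Rightarrow\|x\|_Y\le\|y\|_Y$. $\overline I(f,g,h)=(I_1f,I_2g,I_3h)$; $\overline A\,\overline L(z_1,z_2,z_3)=\sum_iA_iL_iz_i$. A method of recovery is an arbitrary map $\Phi:\mathbb{R}^{n_1}\times\mathbb{R}^{n_2}\times\mathbb{R}^{n_3}\to Y$; $\mathcal{E}(\overline A;\overline W;\overline I;\overline U;\Phi)=\sup_{\overline x\in\overline W}\sup_{\overline z\in\overline I\,\overline x+\overline U}\|\overline A\,\overline x-\Phi\overline z\|_Y$; $\mathcal{E}(\overline A;\overline W;\overline I;\overline U)$ is its infimum over $\Phi$; a method is optimal if it attains this infimum. *)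

theory Defs
  imports "HOL-Analysis.Analysis"
begin

section \<open>Submanifolds of the plane and their Lebesgue measure\<close>

text \<open>The half-plane, a half-line and a point, all realised inside the plane, are the local models
  for manifolds (possibly with boundary) of dimension 2, 1 and 0.  No smoothness is demanded;
  smooth submanifolds, with or without boundary or corners, are special cases.\<close>

definition model_space :: "nat \<Rightarrow> (real \<times> real) set" where
  "model_space d = (if d = 0 then {(0, 0)} else if d = 1 then {0..} \<times> {0} else UNIV \<times> {0..})"

definition submanifold :: "nat \<Rightarrow> (real \<times> real) set \<Rightarrow> bool" where
  "submanifold d N \<longleftrightarrow> d \<le> 2 \<and>
     (\<forall>p\<in>N. \<exists>V U. openin (top_of_set N) V \<and> p \<in> V \<and>
        openin (top_of_set (model_space d)) U \<and> V homeomorphic U)"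

text \<open>One-dimensional Hausdorff outer measure, which on rectifiable simple curves is arc length.
  Boundedness is required because \<^const>\<open>diameter\<close> is meaningless on unbounded sets.\<close>

definition length_outer :: "'a::metric_space set \<Rightarrow> ennreal" where
  "length_outer A = (SUP \<delta>\<in>{0<..}.
     INF C\<in>{C :: nat \<Rightarrow> 'a set. A \<subseteq> (\<Union>i. C i) \<and> (\<forall>i. bounded (C i) \<and> diameter (C i) \<le> \<delta>)}.
       \<Sum>i. ennreal (diameter (C i)))"

text \<open>Here \<^const>\<open>lambda_system\<close> is the \<open>\<sigma>\<close>-algebra of Caratheodory measurable sets.\<close>

definition length_on :: "'a::metric_space set \<Rightarrow> 'a measure" where
  "length_on N = measure_of N (lambda_system N (Pow N) length_outer) length_outer"

definition manifold_measure :: "nat \<Rightarrow> (real \<times> real) set \<Rightarrow> (real \<times> real) measure" where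
  "manifold_measure d N =
     (if d = 0 then count_space N else if d = 1 then length_on N else lebesgue_on N)"

lemma outer_measure_space_length_outer:
  "outer_measure_space (Pow N) (length_outer :: 'a::metric_space set \<Rightarrow> ennreal)"
proof -
  define D where "D \<delta> A = {C :: nat \<Rightarrow> 'a set. A \<subseteq> (\<Union>i. C i) \<and>
     (\<forall>i. bounded (C i) \<and> diameter (C i) \<le> \<delta>)}" for \<delta> A
  define H where "H \<delta> A = (INF C\<in>D \<delta> A. \<Sum>i. ennreal (diameter (C i)))" for \<delta> A
  have L: "length_outer A = (SUP \<delta>\<in>{0<..}. H \<delta> A)" for A :: "'a set"
    by (simp add: length_outer_def H_def D_def)
  have H_empty: "H \<delta> {} = 0" if "\<delta> > 0" for \<delta>
  proof -
    have "(\<lambda>_. {}) \<in> D \<delta> {}" using that by (auto simp: D_def)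
    then have "H \<delta> {} \<le> (\<Sum>i. ennreal (diameter ((\<lambda>_::nat. {} :: 'a set) i)))"
      unfolding H_def by (rule INF_lower)
    then show ?thesis by simp
  qed
  have H_mono: "H \<delta> A \<le> H \<delta> B" if "A \<subseteq> B" for \<delta> A B
    unfolding H_def by (rule INF_superset_mono) (use that in \<open>auto simp: D_def\<close>)
  have H_sub: "H \<delta> (\<Union>i. A i) \<le> (\<Sum>i. H \<delta> (A i))" for \<delta> and A :: "nat \<Rightarrow> 'a set"
  proof (cases "(\<Sum>i. H \<delta> (A i)) = \<infinity>")
    case False
    have fin: "H \<delta> (A i) < \<infinity>" for i
    proof (rule ccontr)
      assume "\<not> H \<delta> (A i) < \<infinity>"
      moreover have "H \<delta> (A i) \<le> (\<Sum>i. H \<delta> (A i))"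
        using sum_le_suminf[of "\<lambda>i. H \<delta> (A i)" "{i}"] by simp
      ultimately show False using False by (simp add: top_unique less_top[symmetric])
    qed
    show ?thesis
    proof (rule ennreal_le_epsilon)
      fix e :: real assume e: "0 < e"
      have "\<exists>C\<in>D \<delta> (A i). (\<Sum>k. ennreal (diameter (C k))) < H \<delta> (A i) + ennreal (e * (1/2)^Suc i)" for i
      proof -
        have "H \<delta> (A i) < H \<delta> (A i) + ennreal (e * (1/2)^Suc i)"
          using fin[of i] e by (cases "H \<delta> (A i)") (auto simp flip: ennreal_plus simp: ennreal_less_iff)
        then show ?thesis unfolding H_def by (subst (asm) INF_less_iff) auto
      qed
      then obtain C where C: "\<And>i. C i \<in> D \<delta> (A i)"
        "\<And>i. (\<Sum>k. ennreal (diameter (C i k))) < H \<delta> (A i) + ennreal (e * (1/2)^Suc i)"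
        by metis
      define E where "E n = C (fst (prod_decode n)) (snd (prod_decode n))" for n
      have cov: "A i \<subseteq> (\<Union>k. C i k)" for i using C(1)[of i] by (simp add: D_def)
      have E_eq: "C i k = E (prod_encode (i, k))" for i k by (simp add: E_def)
      have "(\<Union>i. A i) \<subseteq> (\<Union>n. E n)"
      proof
        fix x assume "x \<in> (\<Union>i. A i)"
        then obtain i k where "x \<in> C i k" using cov by blast
        then show "x \<in> (\<Union>n. E n)" unfolding E_eq by blast
      qed
      moreover have "bounded (E n) \<and> diameter (E n) \<le> \<delta>" for n
        using C(1)[of "fst (prod_decode n)"] unfolding E_def D_def by blast
      ultimately have "E \<in> D \<delta> (\<Union>i. A i)" by (simp add: D_def)
      then have "H \<delta> (\<Union>i. A i) \<le> (\<Sum>n. ennreal (diameter (E n)))"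
        unfolding H_def by (rule INF_lower)
      also have "\<dots> = (\<Sum>i. \<Sum>k. ennreal (diameter (C i k)))"
        using suminf_ennreal_2dimen[where f = "\<lambda>(i,k). ennreal (diameter (C i k))"
            and g = "\<lambda>i. \<Sum>k. ennreal (diameter (C i k))"]
        by (simp add: E_def o_def case_prod_beta)
      also have "\<dots> \<le> (\<Sum>i. H \<delta> (A i) + ennreal (e * (1/2)^Suc i))"
        by (intro suminf_le less_imp_le C(2)) auto
      also have "\<dots> = (\<Sum>i. H \<delta> (A i)) + (\<Sum>i. ennreal (e * (1/2)^Suc i))"
        by (intro suminf_add[symmetric]) auto
      also have "(\<Sum>i. ennreal (e * (1/2)^Suc i)) = ennreal e"
        using e sums_mult[OF power_half_series, of e]
        by (intro suminf_ennreal_eq) auto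
      finally show "H \<delta> (\<Union>i. A i) \<le> (\<Sum>i. H \<delta> (A i)) + ennreal e" .
    qed
  qed simp
  show ?thesis
    unfolding outer_measure_space_def positive_def increasing_def countably_subadditive_def
  proof (intro conjI allI impI ballI)
    have "length_outer ({} :: 'a set) = (SUP \<delta>\<in>{0::real<..}. 0)"
      unfolding L by (intro SUP_cong refl) (simp add: H_empty)
    then show "length_outer ({} :: 'a set) = 0" by (simp add: SUP_eq_const)
  next
    fix A B :: "'a set" assume "A \<subseteq> B"
    then show "length_outer A \<le> length_outer B"
      unfolding L by (intro SUP_mono) (auto intro: H_mono)
  next
    fix A :: "nat \<Rightarrow> 'a set"
    have "H \<delta> (\<Union>i. A i) \<le> (\<Sum>i. length_outer (A i))" if "\<delta> > 0" for \<delta>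
      by (rule order.trans[OF H_sub], intro suminf_le) (use that in \<open>auto simp: L intro: SUP_upper\<close>)
    then show "length_outer (\<Union>i. A i) \<le> (\<Sum>i. length_outer (A i))"
      unfolding L[of "\<Union>i. A i"] by (intro SUP_least) auto
  qed
qed

lemma
  fixes N :: "'a::metric_space set"
  shows space_length_on: "space (length_on N) = N"
    and sets_length_on: "sets (length_on N) = lambda_system N (Pow N) length_outer"
    and emeasure_length_on:
      "A \<in> lambda_system N (Pow N) length_outer \<Longrightarrow> emeasure (length_on N) A = length_outer A"
proof -
  interpret sigma_algebra N "Pow N" by (rule sigma_algebra_Pow)
  have m: "measure_space N (lambda_system N (Pow N) length_outer) length_outer"
    by (rule caratheodory_lemma[OF outer_measure_space_length_outer])
  then have s: "sigma_algebra N (lambda_system N (Pow N) length_outer)"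
    by (simp add: measure_space_def)
  show "space (length_on N) = N" unfolding length_on_def
    by (rule space_measure_of) (auto simp: lambda_system_def)
  show sets: "sets (length_on N) = lambda_system N (Pow N) length_outer"
    unfolding length_on_def by (rule sigma_algebra.sets_measure_of_eq[OF s])
  show "emeasure (length_on N) A = length_outer A"
    if "A \<in> lambda_system N (Pow N) length_outer"
  proof (rule emeasure_measure_of[OF length_on_def])
    show "lambda_system N (Pow N) length_outer \<subseteq> Pow N" by (auto simp: lambda_system_def)
    show "A \<in> sets (length_on N)" using that sets by simp
    show "positive (sets (length_on N)) length_outer"
      "countably_additive (sets (length_on N)) length_outer"
      using m unfolding sets by (auto simp: measure_space_def)
  qed
qed


section \<open>Normed lattices of measurable functions\<close>

text \<open>Elements of the space of measurable, almost everywhere finite functions modulo almost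
  everywhere equality are represented by real-valued measurable functions.  Accordingly
  \<^term>\<open>Y\<close> is a set of such functions closed under almost everywhere equality, and
  \<^term>\<open>nrm\<close> respects that equality.  The supremum in the lattice clause is taken
  within \<^term>\<open>Y\<close>, for the inherited order.  The last clause uses the pointwise modulus: it is
  implied by the same clause for the modulus of the lattice \<^term>\<open>Y\<close>, since every upper bound of
  \<open>y\<close> and \<open>-y\<close> dominates \<open>\<bar>y\<bar>\<close>.\<close>

definition normed_lattice :: "'a measure \<Rightarrow> ('a \<Rightarrow> real) set \<Rightarrow> (('a \<Rightarrow> real) \<Rightarrow> real) \<Rightarrow> bool" where
  "normed_lattice M Y nrm \<longleftrightarrow>
     Y \<subseteq> borel_measurable M \<and>
     (\<forall>x\<in>Y. \<forall>y\<in>borel_measurable M. (AE t in M. x t = y t) \<longrightarrow> y \<in> Y \<and> nrm y = nrm x) \<and>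
     (\<lambda>_. 0) \<in> Y \<and>
     (\<forall>x\<in>Y. \<forall>y\<in>Y. (\<lambda>t. x t + y t) \<in> Y \<and> nrm (\<lambda>t. x t + y t) \<le> nrm x + nrm y) \<and>
     (\<forall>c. \<forall>x\<in>Y. (\<lambda>t. c * x t) \<in> Y \<and> nrm (\<lambda>t. c * x t) = \<bar>c\<bar> * nrm x) \<and>
     (\<forall>x\<in>Y. 0 \<le> nrm x \<and> (nrm x = 0 \<longleftrightarrow> (AE t in M. x t = 0))) \<and>
     (\<forall>x\<in>Y. \<forall>y\<in>Y. \<exists>s\<in>Y. (AE t in M. x t \<le> s t) \<and> (AE t in M. y t \<le> s t) \<and>
        (\<forall>z\<in>Y. (AE t in M. x t \<le> z t) \<and> (AE t in M. y t \<le> z t) \<longrightarrow> (AE t in M. s t \<le> z t))) \<and>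
     (\<forall>x\<in>Y. \<forall>y\<in>Y. (AE t in M. \<bar>x t\<bar> \<le> \<bar>y t\<bar>) \<longrightarrow> nrm x \<le> nrm y)"


section \<open>Classes of functions, information, and the method\<close>

definition modulus_of_continuity :: "(real \<Rightarrow> real) \<Rightarrow> bool" where
  "modulus_of_continuity \<omega> \<longleftrightarrow>
     \<omega> ` {0..} \<subseteq> {0..} \<and> continuous_on {0..} \<omega> \<and> mono_on {0..} \<omega> \<and> \<omega> 0 = 0 \<and>
     (\<forall>s\<ge>0. \<forall>t\<ge>0. \<omega> (s + t) \<le> \<omega> s + \<omega> t)"

text \<open>Below, \<^term>\<open>M\<close> is the ambient space and \<^term>\<open>K\<close> its compact subset; functions on the
  ambient space that vanish off \<^term>\<open>K\<close> are extended by 0 to the whole type.\<close>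

definition bounded_borel :: "'a::topological_space set \<Rightarrow> ('a \<Rightarrow> real) set" where
  "bounded_borel K = {x \<in> borel_measurable borel. bounded (range x) \<and> (\<forall>t. t \<notin> K \<longrightarrow> x t = 0)}"

definition H_class :: "'a::metric_space set \<Rightarrow> (real \<Rightarrow> real) \<Rightarrow> 'a set \<Rightarrow> ('a \<Rightarrow> real) set" where
  "H_class M \<omega> K = {x. (\<exists>y. continuous_on M y \<and> x = (\<lambda>t. y t * indicator K t)) \<and>
     (\<forall>t\<in>K. \<forall>t'\<in>K. \<bar>x t - x t'\<bar> \<le> \<omega> (dist t t'))}"

text \<open>The index type \<^typ>\<open>'n\<close> is a finite linear order, standing for \<open>{1,\<dots>,n}\<close> with its
  usual order.\<close>

definition info :: "('n::finite \<Rightarrow> 'a) \<Rightarrow> ('a \<Rightarrow> real) \<Rightarrow> real ^ 'n" where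
  "info q x = (\<chi> j. x (q j))"

definition error_box :: "real ^ 'n::finite \<Rightarrow> (real ^ 'n) set" where
  "error_box e = {z. \<forall>j. z $ j \<in> {- (e $ j)..e $ j}}"

definition tau :: "(real \<Rightarrow> real) \<Rightarrow> 'a::metric_space set \<Rightarrow> ('n::finite \<Rightarrow> 'a) \<Rightarrow> real ^ 'n \<Rightarrow> 'a \<Rightarrow> real"
  where "tau \<omega> K q e t = (if t \<in> K then MIN j. e $ j + \<omega> (dist t (q j)) else 0)"

definition cell' ::
  "(real \<Rightarrow> real) \<Rightarrow> 'a::metric_space set \<Rightarrow> ('n::finite \<Rightarrow> 'a) \<Rightarrow> real ^ 'n \<Rightarrow> 'n \<Rightarrow> 'a set"
  where "cell' \<omega> K q e j = {t \<in> K. tau \<omega> K q e t = e $ j + \<omega> (dist t (q j))}"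

function cell ::
  "(real \<Rightarrow> real) \<Rightarrow> 'a::metric_space set \<Rightarrow> ('n::{finite,linorder} \<Rightarrow> 'a) \<Rightarrow> real ^ 'n::{finite,linorder} \<Rightarrow> 'n \<Rightarrow> 'a set"
  where "cell \<omega> K q e j = cell' \<omega> K q e j - (\<Union>s\<in>{..<j}. cell \<omega> K q e s)"
  by pat_completeness auto
termination
  by (relation "Wellfounded.measure (\<lambda>(\<omega>, K, q, e, j). card {..<j})")
    (auto intro!: psubset_card_mono simp: lessThan_strict_subset_iff)

declare cell.simps [simp del]

lemma ex1_cell:
  fixes q :: "'n::{finite,linorder} \<Rightarrow> 'a::metric_space"
  assumes "t \<in> K"
  shows "\<exists>!j. t \<in> cell \<omega> K q e j"
proof (rule ex_ex1I)
  let ?J = "{j. t \<in> cell' \<omega> K q e j}"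
  have "(MIN j. e $ j + \<omega> (dist t (q j))) \<in> range (\<lambda>j. e $ j + \<omega> (dist t (q j)))"
    by (rule Min_in) auto
  then obtain i where "(MIN j. e $ j + \<omega> (dist t (q j))) = e $ i + \<omega> (dist t (q i))" by blast
  then have "i \<in> ?J" using assms by (simp add: cell'_def tau_def)
  then have "?J \<noteq> {}" by blast
  then have "Min ?J \<in> ?J" by (intro Min_in) auto
  moreover have "t \<notin> cell \<omega> K q e s" if "s < Min ?J" for s
  proof -
    have "finite ?J" by (rule finite)
    then have "s \<notin> ?J" using that Min_le leD by blast
    then show ?thesis by (subst cell.simps) simp
  qed
  ultimately have "t \<in> cell \<omega> K q e (Min ?J)" by (subst cell.simps) auto
  then show "\<exists>j. t \<in> cell \<omega> K q e j" ..
next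
  have "False" if "t \<in> cell \<omega> K q e i" "t \<in> cell \<omega> K q e j" "i < j" for i j
    using that by (subst (asm) (2) cell.simps) auto
  then show "i = j" if "t \<in> cell \<omega> K q e i" "t \<in> cell \<omega> K q e j" for i j
    using that by (meson linorder_cases)
qed

definition L_op ::
  "(real \<Rightarrow> real) \<Rightarrow> 'a::metric_space set \<Rightarrow> ('n::{finite,linorder} \<Rightarrow> 'a) \<Rightarrow> real ^ 'n::{finite,linorder} \<Rightarrow>
   real ^ 'n::{finite,linorder} \<Rightarrow> 'a \<Rightarrow> real"
  where "L_op \<omega> K q e z t = (if t \<in> K then z $ (THE j. t \<in> cell \<omega> K q e j) else 0)"


section \<open>Recovery of operators\<close>

definition recovery_error ::
  "(('b \<Rightarrow> real) \<Rightarrow> real) \<Rightarrow> ('x \<Rightarrow> 'b \<Rightarrow> real) \<Rightarrow> 'x set \<Rightarrow> ('x \<Rightarrow> 'z::plus) \<Rightarrow> 'z set \<Rightarrow>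
   ('z \<Rightarrow> 'b \<Rightarrow> real) \<Rightarrow> ereal"
  where "recovery_error nrm A W I U \<Phi> =
    (SUP x\<in>W. SUP z\<in>{I x + u | u. u \<in> U}. ereal (nrm (\<lambda>p. A x p - \<Phi> z p)))"

definition optimal_error ::
  "('b \<Rightarrow> real) set \<Rightarrow> (('b \<Rightarrow> real) \<Rightarrow> real) \<Rightarrow> ('x \<Rightarrow> 'b \<Rightarrow> real) \<Rightarrow> 'x set \<Rightarrow>
   ('x \<Rightarrow> 'z::plus) \<Rightarrow> 'z set \<Rightarrow> ereal"
  where "optimal_error Y nrm A W I U = (INF \<Phi>\<in>{\<Phi>. range \<Phi> \<subseteq> Y}. recovery_error nrm A W I U \<Phi>)"

definition optimal_method ::
  "('b \<Rightarrow> real) set \<Rightarrow> (('b \<Rightarrow> real) \<Rightarrow> real) \<Rightarrow> ('x \<Rightarrow> 'b \<Rightarrow> real) \<Rightarrow> 'x set \<Rightarrow>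
   ('x \<Rightarrow> 'z::plus) \<Rightarrow> 'z set \<Rightarrow> ('z \<Rightarrow> 'b \<Rightarrow> real) \<Rightarrow> bool"
  where "optimal_method Y nrm A W I U \<Phi> \<longleftrightarrow>
    range \<Phi> \<subseteq> Y \<and> recovery_error nrm A W I U \<Phi> = optimal_error Y nrm A W I U"


section \<open>The solution operator of the wave equation\<close>

definition upper_half_plane :: "(real \<times> real) set" where
  "upper_half_plane = UNIV \<times> {0<..}"

definition wave1 :: "(real \<times> real \<Rightarrow> real) \<Rightarrow> real \<times> real \<Rightarrow> real" where
  "wave1 f = (\<lambda>(u, t). 1/2 * (LINT s:{0..t}|lebesgue. (LINT v:{u - s..u + s}|lebesgue. f (v, t - s))))"

definition wave2 :: "(real \<Rightarrow> real) \<Rightarrow> real \<times> real \<Rightarrow> real" where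
  "wave2 g = (\<lambda>(u, t). (g (u - t) + g (u + t)) / 2)"

definition wave3 :: "(real \<Rightarrow> real) \<Rightarrow> real \<times> real \<Rightarrow> real" where
  "wave3 h = (\<lambda>(u, t). 1/2 * (LINT v:{u - t..u + t}|lebesgue. h v))"

definition wave ::
  "(real \<times> real \<Rightarrow> real) \<times> (real \<Rightarrow> real) \<times> (real \<Rightarrow> real) \<Rightarrow> real \<times> real \<Rightarrow> real"
  where "wave = (\<lambda>(f, g, h) p. wave1 f p + wave2 g p + wave3 h p)"

end

theory Submission
  imports Defs
begin

text \<open>The solution operator \<open>A\<close> is linear and monotone.  On the cell of \<open>q\<^sub>j\<close> every \<open>x \<in> W\<close>
  differs from the recovered value by at most \<open>e\<^sub>j + \<omega>(\<rho>(t, q\<^sub>j)) = \<tau>(t)\<close>, so the error of \<open>A L\<close> is at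
  most \<open>\<parallel>A \<tau>\<parallel>\<close>.  Conversely \<open>\<tau>\<close> and \<open>-\<tau>\<close> both lie in \<open>W\<close> and both are compatible with the
  information \<open>0\<close>, so any method \<open>\<Phi>\<close> errs by at least the maximum of \<open>\<parallel>A \<tau> - \<Phi> 0\<parallel>\<close> and
  \<open>\<parallel>- A \<tau> - \<Phi> 0\<parallel>\<close>, which is at least \<open>\<parallel>A \<tau>\<parallel>\<close> by the triangle inequality.\<close>

section \<open>Bounded Borel functions\<close>

lemma bounded_borel_mono: "K \<subseteq> K' \<Longrightarrow> bounded_borel K \<subseteq> bounded_borel K'"
  by (auto simp: bounded_borel_def)

lemma bounded_borel_measurable: "x \<in> bounded_borel K \<Longrightarrow> x \<in> borel_measurable borel"
  by (simp add: bounded_borel_def)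

lemma bounded_borel_bound:
  assumes "x \<in> bounded_borel K"
  obtains C where "0 \<le> C" "\<And>t. \<bar>x t\<bar> \<le> C"
proof -
  obtain C where C: "\<And>t. \<bar>x t\<bar> \<le> C"
    using assms by (auto simp: bounded_borel_def bounded_iff)
  moreover have "0 \<le> C" using C[of undefined] by linarith
  ultimately show thesis using that by blast
qed

lemma bounded_borel_add:
  assumes "x \<in> bounded_borel K" "y \<in> bounded_borel K"
  shows "(\<lambda>t. x t + y t) \<in> bounded_borel K"
proof -
  obtain C D where "\<And>t. \<bar>x t\<bar> \<le> C" "\<And>t. \<bar>y t\<bar> \<le> D"
    using bounded_borel_bound assms by metis
  then have "\<bar>x t + y t\<bar> \<le> C + D" for t by (meson abs_triangle_ineq add_mono order_trans)
  then have "bounded (range (\<lambda>t. x t + y t))" by (auto simp: bounded_iff)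
  then show ?thesis using assms by (auto simp: bounded_borel_def)
qed

lemma bounded_borel_times_indicator:
  assumes "compact K" "continuous_on K y"
  shows "(\<lambda>t. y t * indicator K t) \<in> bounded_borel (K :: 'a::t2_space set)"
proof -
  have "(\<lambda>t. indicator K t *\<^sub>R y t) \<in> borel_measurable borel"
    using assms by (intro borel_measurable_continuous_on_indicator) (auto intro: borel_compact)
  \<comment> \<open>The value 0 joins the compact image because the cutoff takes it off
    \<open>K\<close>.\<close>
  moreover have "bounded (insert 0 (y ` K))"
    using assms by (simp add: compact_continuous_image compact_imp_bounded)
  then have "bounded (range (\<lambda>t. y t * indicator K t))"
    by (rule bounded_subset) (auto simp: indicator_def)
  ultimately show ?thesis by (simp add: bounded_borel_def mult.commute)
qed

lemma bounded_borel_H_class: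
  assumes "compact K" "K \<subseteq> M" "x \<in> H_class M \<omega> K"
  shows "x \<in> bounded_borel K"
  using assms bounded_borel_times_indicator continuous_on_subset unfolding H_class_def by blast

text \<open>Symmetry of the class makes \<open>-\<tau>\<close> admissible as the second witness of
  the lower bound.\<close>

lemma H_class_uminus:
  assumes "x \<in> H_class M \<omega> K"
  shows "(\<lambda>t. - x t) \<in> H_class M \<omega> K"
proof -
  obtain y where y: "continuous_on M y" "x = (\<lambda>t. y t * indicator K t)"
    using assms by (auto simp: H_class_def)
  have "(\<lambda>t. - x t) = (\<lambda>t. (- y t) * indicator K t)" "continuous_on M (\<lambda>t. - y t)"
    using y by (auto intro: continuous_intros)
  moreover have "\<bar>- x t - - x t'\<bar> = \<bar>x t - x t'\<bar>" for t t' by linarith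
  ultimately show ?thesis using assms unfolding H_class_def mem_Collect_eq by metis
qed

section \<open>The extremal function and the piecewise constant recovery\<close>

lemma continuous_on_Min_image:
  fixes f :: "'i \<Rightarrow> 'a::topological_space \<Rightarrow> 'b::linorder_topology"
  assumes "finite J" "J \<noteq> {}" "\<And>j. j \<in> J \<Longrightarrow> continuous_on S (f j)"
  shows "continuous_on S (\<lambda>t. MIN j\<in>J. f j t)"
  using assms by (induction J rule: finite_ne_induct) (auto intro: continuous_on_min)

lemma continuous_on_modulus_dist:
  assumes "modulus_of_continuity \<omega>"
  shows "continuous_on S (\<lambda>t. \<omega> (dist t a))"
proof -
  have "continuous_on {0..} \<omega>" using assms by (simp add: modulus_of_continuity_def)
  then show ?thesis
    by (rule continuous_on_compose2) (auto intro: continuous_intros)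
qed

lemma continuous_on_Min_modulus_dist:
  fixes q :: "'n::finite \<Rightarrow> 'a::metric_space"
  assumes "modulus_of_continuity \<omega>"
  shows "continuous_on S (\<lambda>t. MIN j. e $ j + \<omega> (dist t (q j)))"
  using assms
  by (intro continuous_on_Min_image continuous_on_add continuous_on_const
      continuous_on_modulus_dist) auto

lemma modulus_of_continuity_nonneg: "modulus_of_continuity \<omega> \<Longrightarrow> 0 \<le> s \<Longrightarrow> 0 \<le> \<omega> s"
  unfolding modulus_of_continuity_def image_subset_iff by simp

text \<open>Monotonicity of \<open>\<omega>\<close> is applied to the metric triangle inequality,
  then subadditivity splits the sum: \<open>\<omega>\<close> of the distance behaves like a
  pseudometric.\<close>

lemma modulus_of_continuity_triangle:
  assumes "modulus_of_continuity \<omega>"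
  shows "\<omega> (dist x z) \<le> \<omega> (dist x y) + \<omega> (dist y z)"
proof -
  have "mono_on {0..} \<omega>" using assms by (simp add: modulus_of_continuity_def)
  then have "\<omega> (dist x z) \<le> \<omega> (dist x y + dist y z)"
    by (rule mono_onD) (auto intro: dist_triangle)
  also have "\<dots> \<le> \<omega> (dist x y) + \<omega> (dist y z)"
    using assms by (simp add: modulus_of_continuity_def)
  finally show ?thesis .
qed

section \<open>The extremal function \<open>tau\<close>\<close>

lemma tau_le: "t \<in> K \<Longrightarrow> tau \<omega> K q e t \<le> e $ j + \<omega> (dist t (q j))"
  by (simp add: tau_def)

lemma tau_attained:
  assumes "t \<in> K"
  obtains j where "tau \<omega> K q e t = e $ j + \<omega> (dist t (q j))"
proof -
  have "(MIN j. e $ j + \<omega> (dist t (q j))) \<in> range (\<lambda>j. e $ j + \<omega> (dist t (q j)))"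
    by (rule Min_in) auto
  then show thesis using that assms by (elim rangeE) (simp add: tau_def)
qed

lemma tau_nonneg:
  assumes "modulus_of_continuity \<omega>" "\<And>j. 0 \<le> e $ j"
  shows "0 \<le> tau \<omega> K q e t"
proof (cases "t \<in> K")
  case True
  then obtain j where "tau \<omega> K q e t = e $ j + \<omega> (dist t (q j))" by (rule tau_attained)
  then show ?thesis using assms by (simp add: modulus_of_continuity_nonneg)
qed (simp add: tau_def)

text \<open>The node lies in \<open>K\<close>, and its own index competes in the minimum with
  \<open>e $ j + \<omega> 0\<close>.\<close>

lemma tau_at_node_le:
  assumes "modulus_of_continuity \<omega>" "range q \<subseteq> K"
  shows "tau \<omega> K q e (q j) \<le> e $ j"
proof -
  have "\<omega> 0 = 0" using assms by (simp add: modulus_of_continuity_def)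
  then show ?thesis using tau_le[of "q j" K \<omega> q e j] assms(2) by auto
qed

lemma tau_in_H_class:
  assumes \<omega>: "modulus_of_continuity \<omega>"
  shows "tau \<omega> K q e \<in> H_class M \<omega> K"
proof -
  \<comment> \<open>An index attaining the minimum at \<open>t'\<close> also competes at
    \<open>t\<close>, at an extra cost of at most \<open>\<omega> (dist t t')\<close>. Exchanging
    the points then bounds the absolute value.\<close>
  have le: "tau \<omega> K q e t \<le> tau \<omega> K q e t' + \<omega> (dist t t')" if "t \<in> K" "t' \<in> K" for t t'
  proof -
    obtain j where "tau \<omega> K q e t' = e $ j + \<omega> (dist t' (q j))"
      using \<open>t' \<in> K\<close> by (rule tau_attained)
    then show ?thesis
      using tau_le[OF \<open>t \<in> K\<close>, of \<omega> q e j] modulus_of_continuity_triangle[OF \<omega>, of t "q j" t']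
      by linarith
  qed
  then have "\<bar>tau \<omega> K q e t - tau \<omega> K q e t'\<bar> \<le> \<omega> (dist t t')" if "t \<in> K" "t' \<in> K" for t t'
    using le[OF that] le[OF that(2,1)] by (simp add: dist_commute abs_le_iff)
  \<comment> \<open>The minimum without the cutoff is continuous on the whole space and serves as
    the continuous extension that \<open>H_class\<close> asks for.\<close>
  moreover have "tau \<omega> K q e = (\<lambda>t. (MIN j. e $ j + \<omega> (dist t (q j))) * indicator K t)"
    by (auto simp: tau_def)
  ultimately show ?thesis
    using continuous_on_Min_modulus_dist[OF \<omega>] unfolding H_class_def by blast
qed

section \<open>Measurability and accuracy of the piecewise constant recovery\<close>

lemma borel_cell:
  assumes \<omega>: "modulus_of_continuity \<omega>" and K: "closed K"
  shows "cell \<omega> K q e j \<in> sets borel"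
proof -
  \<comment> \<open>Each \<open>cell'\<close> is the part of the closed set \<open>K\<close> where
    two continuous functions agree, hence closed.\<close>
  have [measurable]: "cell' \<omega> K q e s \<in> sets borel" for s
  proof -
    have "closed {t. (MIN j. e $ j + \<omega> (dist t (q j))) = e $ s + \<omega> (dist t (q s))}"
      using \<omega> by (intro closed_Collect_eq continuous_on_Min_modulus_dist continuous_on_add
          continuous_on_const continuous_on_modulus_dist)
    moreover have "cell' \<omega> K q e s =
        K \<inter> {t. (MIN j. e $ j + \<omega> (dist t (q j))) = e $ s + \<omega> (dist t (q s))}"
      by (auto simp: cell'_def tau_def)
    ultimately show ?thesis using K by auto
  qed
  show ?thesis
  \<comment> \<open>A cell removes only the finitely many earlier ones, so the induction runs over
    the number of earlier indices, the measure that makes \<open>cell\<close> terminate.\<close>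
  proof (induction "card {..<j}" arbitrary: j rule: less_induct)
    case less
    have "cell \<omega> K q e s \<in> sets borel" if "s \<in> {..<j}" for s
      using that by (intro less psubset_card_mono) (auto simp: lessThan_strict_subset_iff)
    then show ?case by (subst cell.simps) auto
  qed
qed

lemma L_op_eq:
  assumes "t \<in> cell \<omega> K q e j"
  shows "L_op \<omega> K q e z t = z $ j"
proof -
  have "t \<in> K" using assms by (subst (asm) cell.simps) (auto simp: cell'_def)
  then show ?thesis using ex1_cell[of t K \<omega> q e] assms by (auto simp: L_op_def the1_equality)
qed

lemma bounded_borel_L_op:
  assumes \<omega>: "modulus_of_continuity \<omega>" and K: "closed K"
  shows "L_op \<omega> K q e z \<in> bounded_borel K"
proof -
  have [measurable]: "cell \<omega> K q e j \<in> sets borel" for j by (rule borel_cell[OF assms])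
  \<comment> \<open>Since the cells partition \<open>K\<close>, \<open>L_op\<close> is a finite
    combination of their indicators, which shows that it is Borel.\<close>
  have "L_op \<omega> K q e z t = (\<Sum>j\<in>UNIV. z $ j * indicator (cell \<omega> K q e j) t)" for t
  proof (cases "t \<in> K")
    case True
    then obtain j where j: "t \<in> cell \<omega> K q e j"
      and cell_iff: "t \<in> cell \<omega> K q e i \<longleftrightarrow> i = j" for i
      using ex1_cell[of t K \<omega> q e] by metis
    have "(\<Sum>i\<in>UNIV. z $ i * indicator (cell \<omega> K q e i) t) = z $ j"
      by (simp add: indicator_def cell_iff)
    then show ?thesis using L_op_eq[OF j] by simp
  next
    case False
    then have "t \<notin> cell \<omega> K q e j" for j by (subst cell.simps) (auto simp: cell'_def)
    then show ?thesis using False by (simp add: L_op_def)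
  qed
  then have "L_op \<omega> K q e z = (\<lambda>t. \<Sum>j\<in>UNIV. z $ j * indicator (cell \<omega> K q e j) t)" ..
  moreover have "(\<lambda>t. \<Sum>j\<in>UNIV. z $ j * indicator (cell \<omega> K q e j) t) \<in> borel_measurable borel"
    by measurable
  ultimately have "L_op \<omega> K q e z \<in> borel_measurable borel" by (simp only:)
  moreover have "bounded (insert 0 (range (\<lambda>j. z $ j)))" by (simp add: finite_imp_bounded)
  then have "bounded (range (L_op \<omega> K q e z))"
    by (rule bounded_subset) (auto simp: L_op_def)
  ultimately show ?thesis by (simp add: bounded_borel_def L_op_def)
qed

text \<open>On the cell of \<open>q j\<close>, replacing \<open>x t\<close> by
  \<open>x (q j)\<close> costs at most \<open>\<omega> (dist t (q j))\<close> and the perturbation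
  at most \<open>e $ j\<close>; the sum is \<open>tau\<close> there. Off \<open>K\<close> all three
  functions vanish.\<close>

lemma L_op_error:
  assumes \<omega>: "modulus_of_continuity \<omega>" and q: "range q \<subseteq> K"
    and x: "x \<in> H_class M \<omega> K" and u: "u \<in> error_box e"
  shows "\<bar>x t - L_op \<omega> K q e (info q x + u) t\<bar> \<le> tau \<omega> K q e t"
proof (cases "t \<in> K")
  case True
  then obtain j where j: "t \<in> cell \<omega> K q e j" using ex1_cell[of t K \<omega> q e] by metis
  then have "t \<in> cell' \<omega> K q e j" by (subst (asm) cell.simps) auto
  then have "tau \<omega> K q e t = e $ j + \<omega> (dist t (q j))" by (simp add: cell'_def)
  moreover have "\<bar>x t - x (q j)\<bar> \<le> \<omega> (dist t (q j))"
    using x True q by (auto simp: H_class_def)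
  moreover have "- (e $ j) \<le> u $ j \<and> u $ j \<le> e $ j" using u by (simp add: error_box_def)
  ultimately show ?thesis unfolding L_op_eq[OF j]
    by (simp add: info_def abs_le_iff)
next
  case False
  then show ?thesis using x by (auto simp: H_class_def L_op_def tau_def)
qed

section \<open>The solution operator is linear and monotone\<close>

lemma set_integrable_bounded_borel:
  fixes f :: "real \<Rightarrow> real"
  assumes "f \<in> bounded_borel K"
  shows "set_integrable lebesgue {a..b} f"
proof -
  obtain C where "\<And>t. \<bar>f t\<bar> \<le> C" using bounded_borel_bound[OF assms] by metis
  then show ?thesis unfolding set_integrable_def
    using bounded_borel_measurable[OF assms]
    by (intro integrableI_bounded_set_indicator[where B = C]) (auto intro: measurable_completion simp: emeasure_lborel_Icc_eq)
qed

text \<open>Serves the inner integral of \<open>wave1\<close>, which freezes the time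
  coordinate.\<close>

lemma bounded_borel_slice:
  fixes f :: "'a::topological_space \<times> 'b::topological_space \<Rightarrow> real"
  assumes "f \<in> bounded_borel UNIV"
  shows "(\<lambda>v. f (v, s)) \<in> bounded_borel UNIV"
proof -
  have "(\<lambda>v. (v, s)) \<in> borel_measurable borel"
    by (intro borel_measurable_continuous_onI continuous_intros)
  then have "(\<lambda>v. f (v, s)) \<in> borel_measurable borel"
    using measurable_compose bounded_borel_measurable[OF assms] by blast
  moreover have "bounded (range (\<lambda>v. f (v, s)))"
    using assms by (auto simp: bounded_borel_def intro: bounded_subset)
  ultimately show ?thesis by (simp add: bounded_borel_def)
qed

lemma set_integrable_wave1_inner:
  fixes f :: "real \<times> real \<Rightarrow> real"
  assumes f: "f \<in> bounded_borel UNIV"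
  shows "set_integrable lebesgue {0..t} (\<lambda>s. LINT v:{u - s..u + s}|lebesgue. f (v, t - s))"
proof -
  have m: "f \<in> borel_measurable borel" using f by (rule bounded_borel_measurable)
  then have [measurable]: "f \<in> borel_measurable (borel \<Otimes>\<^sub>M borel)" by (simp add: borel_prod)
  obtain C where C: "0 \<le> C" "\<And>p. \<bar>f p\<bar> \<le> C" using bounded_borel_bound[OF f] by metis
  let ?G = "\<lambda>s. LINT v:{u - s..u + s}|lebesgue. f (v, t - s)"
  \<comment> \<open>The domain of integration depends on \<open>s\<close>. Moving it into the
    integrand and passing to \<open>lborel\<close> leaves a jointly Borel integrand over a
    sigma-finite measure, so measurability in \<open>s\<close> follows as in Fubini's
    theorem.\<close>
  have "?G s = (LINT v|lborel. (if u - s \<le> v \<and> v \<le> u + s then f (v, t - s) else 0))" for s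
  proof -
    have "?G s = (LINT v|lebesgue. (if u - s \<le> v \<and> v \<le> u + s then f (v, t - s) else 0))"
      unfolding set_lebesgue_integral_def by (intro Bochner_Integration.integral_cong) auto
    also have "\<dots> = (LINT v|lborel. (if u - s \<le> v \<and> v \<le> u + s then f (v, t - s) else 0))"
      by (rule integral_completion) measurable
    finally show ?thesis .
  qed
  moreover have "(\<lambda>s. LINT v|lborel. (if u - s \<le> v \<and> v \<le> u + s then f (v, t - s) else 0))
      \<in> borel_measurable borel"
    by measurable
  ultimately have "?G \<in> borel_measurable borel" by simp
  then have G: "?G \<in> borel_measurable lebesgue" by (simp add: measurable_completion)
  \<comment> \<open>The inner interval has length \<open>2 * s\<close>, at most
    \<open>2 * t\<close>.\<close>
  have bound: "\<bar>?G s\<bar> \<le> C * (2 * t)" if "0 \<le> s" "s \<le> t" for s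
  proof -
    have "\<bar>?G s\<bar> \<le> (LINT v:{u - s..u + s}|lebesgue. \<bar>f (v, t - s)\<bar>)"
      using set_integral_norm_bound[OF set_integrable_bounded_borel[OF bounded_borel_slice[OF f]]]
      by simp
    also have "\<dots> \<le> (LINT v:{u - s..u + s}|lebesgue. C)"
      using C bounded_borel_slice[OF f]
      by (intro set_integral_mono set_integrable_abs set_integrable_bounded_borel[where K = UNIV])
        (auto simp: bounded_borel_def)
    also have "\<dots> = C * (2 * s)" using that by (simp add: set_lebesgue_integral_def)
    also have "\<dots> \<le> C * (2 * t)" using that C by (simp add: mult_left_mono)
    finally show ?thesis .
  qed
  show ?thesis unfolding set_integrable_def
    using bound G by (intro integrableI_bounded_set_indicator[where B = "C * (2 * t)"])
      (auto simp: emeasure_lborel_Icc_eq)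
qed

lemma wave_uminus:
  "wave (\<lambda>p. - f p, \<lambda>v. - g v, \<lambda>v. - h v) p = - wave (f, g, h) p"
  \<comment> \<open>Negation commutes with every integral: a nonintegrable function and its negative
    both have integral 0.\<close>
  by (cases p) (simp add: wave_def wave1_def wave2_def wave3_def set_lebesgue_integral_def field_simps)

lemma wave1_add:
  assumes "f \<in> bounded_borel UNIV" "f' \<in> bounded_borel UNIV"
  shows "wave1 (\<lambda>p. f p + f' p) p = wave1 f p + wave1 f' p"
proof -
  obtain u t where p: "p = (u, t)" by (cases p)
  have "(LINT v:{u - s..u + s}|lebesgue. f (v, t - s) + f' (v, t - s)) =
      (LINT v:{u - s..u + s}|lebesgue. f (v, t - s)) + (LINT v:{u - s..u + s}|lebesgue. f' (v, t - s))" for s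
    using assms by (intro set_integral_add set_integrable_bounded_borel[where K = UNIV] bounded_borel_slice)
  then show ?thesis
    using assms by (simp add: wave1_def p set_integral_add set_integrable_wave1_inner distrib_left)
qed

lemma wave_add:
  assumes "f \<in> bounded_borel UNIV" "h \<in> bounded_borel UNIV"
    and "f' \<in> bounded_borel UNIV" "h' \<in> bounded_borel UNIV"
  shows "wave (\<lambda>p. f p + f' p, \<lambda>v. g v + g' v, \<lambda>v. h v + h' v) p = wave (f, g, h) p + wave (f', g', h') p"
  using assms
  by (cases p)
    (simp add: wave_def wave1_add wave2_def wave3_def set_integral_add
      set_integrable_bounded_borel[where K = UNIV] field_simps)

text \<open>Comparing integrals requires integrability of both sides, which the bounded Borel data
  provide; \<open>wave2\<close> is compared pointwise. The inequality covers the whole plane, the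
  outer intervals of integration being empty for negative time.\<close>

lemma wave_mono:
  assumes "f \<in> bounded_borel UNIV" "h \<in> bounded_borel UNIV"
    and "f' \<in> bounded_borel UNIV" "h' \<in> bounded_borel UNIV"
    and le: "\<And>p. f p \<le> f' p" "\<And>v. g v \<le> g' v" "\<And>v. h v \<le> h' v"
  shows "wave (f, g, h) p \<le> wave (f', g', h') p"
proof -
  obtain u t where p: "p = (u, t)" by (cases p)
  have "wave1 f p \<le> wave1 f' p" unfolding wave1_def p prod.case
    using assms by (intro mult_left_mono set_integral_mono set_integrable_wave1_inner
        set_integrable_bounded_borel[where K = UNIV] bounded_borel_slice) auto
  moreover have "wave2 g p \<le> wave2 g' p" unfolding wave2_def p
    using le(2)[of "u - t"] le(2)[of "u + t"] by simp
  moreover have "wave3 h p \<le> wave3 h' p" unfolding wave3_def p prod.case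
    using assms by (intro mult_left_mono set_integral_mono set_integrable_bounded_borel) auto
  ultimately show ?thesis by (simp add: wave_def)
qed

text \<open>From \<open>f \<le> f' + F\<close> and its analogues, monotonicity and additivity give
  one half; exchanging the two triples gives the other.\<close>

lemma wave_diff_le:
  assumes bb: "f \<in> bounded_borel UNIV" "h \<in> bounded_borel UNIV"
      "f' \<in> bounded_borel UNIV" "h' \<in> bounded_borel UNIV"
      "F \<in> bounded_borel UNIV" "H \<in> bounded_borel UNIV"
    and le: "\<And>p. \<bar>f p - f' p\<bar> \<le> F p" "\<And>v. \<bar>g v - g' v\<bar> \<le> G v" "\<And>v. \<bar>h v - h' v\<bar> \<le> H v"
  shows "\<bar>wave (f, g, h) p - wave (f', g', h') p\<bar> \<le> wave (F, G, H) p"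
proof -
  have *: "wave (f1, g1, h1) p \<le> wave (f2, g2, h2) p + wave (F, G, H) p"
    if "f1 \<in> bounded_borel UNIV" "h1 \<in> bounded_borel UNIV"
      "f2 \<in> bounded_borel UNIV" "h2 \<in> bounded_borel UNIV"
      "\<And>p. \<bar>f1 p - f2 p\<bar> \<le> F p" "\<And>v. \<bar>g1 v - g2 v\<bar> \<le> G v" "\<And>v. \<bar>h1 v - h2 v\<bar> \<le> H v"
    for f1 f2 g1 g2 h1 h2
  proof -
    have "f1 p \<le> f2 p + F p" "g1 v \<le> g2 v + G v" "h1 v \<le> h2 v + H v" for p v
      using that(5)[of p] that(6,7)[of v] by linarith+
    then show ?thesis
      unfolding wave_add[OF that(3,4) bb(5,6), symmetric]
      using that(1-4) bb(5,6) by (intro wave_mono bounded_borel_add)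
  qed
  from *[OF bb(1-4) le] *[OF bb(3,4,1,2), of g' g] le
  show ?thesis by (simp add: abs_le_iff abs_minus_commute)
qed

section \<open>Optimal recovery\<close>

lemma normed_lattice_abs_le:
  assumes "normed_lattice M Y nrm" "x \<in> Y" "y \<in> Y" "\<And>t. \<bar>x t\<bar> \<le> y t"
  shows "nrm x \<le> nrm y"
proof -
  have "AE t in M. \<bar>x t\<bar> \<le> \<bar>y t\<bar>"
    using assms(4) by (intro AE_I2) (meson abs_ge_self order_trans)
  then show ?thesis using assms(1-3) unfolding normed_lattice_def by blast
qed

lemma normed_lattice_add:
  assumes "normed_lattice M Y nrm" "x \<in> Y" "y \<in> Y"
  shows "(\<lambda>t. x t + y t) \<in> Y" "nrm (\<lambda>t. x t + y t) \<le> nrm x + nrm y"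
  using assms unfolding normed_lattice_def by blast+

lemma normed_lattice_scale:
  assumes "normed_lattice M Y nrm" "x \<in> Y"
  shows "(\<lambda>t. c * x t) \<in> Y" "nrm (\<lambda>t. c * x t) = \<bar>c\<bar> * nrm x"
  using assms unfolding normed_lattice_def by blast+

lemma normed_lattice_diff:
  assumes "normed_lattice M Y nrm" "x \<in> Y" "y \<in> Y"
  shows "(\<lambda>t. x t - y t) \<in> Y"
  using normed_lattice_add(1)[OF assms(1,2) normed_lattice_scale(1)[OF assms(1,3), of "-1"]] by simp

text \<open>Since \<open>2 x = (x - y) - (- x - y)\<close>, the two errors have norms summing to at
  least \<open>2 * nrm x\<close>.\<close>

lemma normed_lattice_symmetric_error:
  assumes nl: "normed_lattice M Y nrm" and "x \<in> Y" "y \<in> Y"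
  shows "nrm x \<le> max (nrm (\<lambda>t. x t - y t)) (nrm (\<lambda>t. - x t - y t))"
proof -
  let ?a = "\<lambda>t. x t - y t" and ?b = "\<lambda>t. (- 1) * (- x t - y t)"
  have mx: "(\<lambda>t. - x t) \<in> Y" using normed_lattice_scale(1)[OF nl \<open>x \<in> Y\<close>, of "-1"] by simp
  have a: "?a \<in> Y" and b': "(\<lambda>t. - x t - y t) \<in> Y"
    using normed_lattice_diff[OF nl] assms(2,3) mx by auto
  have b: "?b \<in> Y" "nrm ?b = nrm (\<lambda>t. - x t - y t)"
    using normed_lattice_scale[OF nl b', of "-1"] by simp_all
  have "2 * nrm x = nrm (\<lambda>t. 2 * x t)" using normed_lattice_scale(2)[OF nl \<open>x \<in> Y\<close>, of 2] by simp
  also have "(\<lambda>t. 2 * x t) = (\<lambda>t. ?a t + ?b t)" by auto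
  also have "nrm \<dots> \<le> nrm ?a + nrm ?b" by (rule normed_lattice_add(2)[OF nl a b(1)])
  finally show ?thesis using b(2) by linarith
qed

text \<open>A two-point argument: the information \<open>z\<close> may stem from
  \<open>\<tau>\<close> or from \<open>\<sigma>\<close>, so a method answers both alike although
  \<open>A\<close> takes opposite values on them.\<close>

lemma optimal_method_if_symmetric_witness:
  assumes nl: "normed_lattice M Y nrm"
    and \<Phi>: "range \<Phi> \<subseteq> Y"
    and upper: "\<And>x u. x \<in> W \<Longrightarrow> u \<in> U \<Longrightarrow> nrm (\<lambda>p. A x p - \<Phi> (I x + u) p) \<le> nrm (A \<tau>)"
    and \<tau>: "\<tau> \<in> W" "A \<tau> \<in> Y" and \<sigma>: "\<sigma> \<in> W" "\<And>p. A \<sigma> p = - A \<tau> p"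
    and compat: "z \<in> {I \<tau> + u | u. u \<in> U}" "z \<in> {I \<sigma> + u | u. u \<in> U}"
  shows "optimal_method Y nrm A W I U \<Phi> \<and>
    optimal_error Y nrm A W I U = recovery_error nrm A W I U \<Phi> \<and>
    recovery_error nrm A W I U \<Phi> = ereal (nrm (A \<tau>))"
proof -
  \<comment> \<open>The bound is stated for every method: for \<open>\<Phi>\<close> it matches the
    upper bound, and over all methods it bounds the infimum.\<close>
  have lower: "ereal (nrm (A \<tau>)) \<le> recovery_error nrm A W I U \<Psi>" if "range \<Psi> \<subseteq> Y" for \<Psi>
  proof -
    have err: "ereal (nrm (\<lambda>p. A x p - \<Psi> z p)) \<le> recovery_error nrm A W I U \<Psi>"
      if "x \<in> W" "z \<in> {I x + u | u. u \<in> U}" for x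
      unfolding recovery_error_def by (rule SUP_upper2[OF that(1)], rule SUP_upper[OF that(2)])
    have "nrm (A \<tau>) \<le> max (nrm (\<lambda>p. A \<tau> p - \<Psi> z p)) (nrm (\<lambda>p. - A \<tau> p - \<Psi> z p))"
      using that by (intro normed_lattice_symmetric_error[OF nl \<tau>(2)]) auto
    then have "ereal (nrm (A \<tau>)) \<le>
        max (ereal (nrm (\<lambda>p. A \<tau> p - \<Psi> z p))) (ereal (nrm (\<lambda>p. A \<sigma> p - \<Psi> z p)))"
      by (simp add: \<sigma>(2) max_def split: if_splits)
    also have "\<dots> \<le> recovery_error nrm A W I U \<Psi>"
      using err[OF \<tau>(1) compat(1)] err[OF \<sigma>(1) compat(2)] by simp
    finally show ?thesis .
  qed
  have "recovery_error nrm A W I U \<Phi> \<le> ereal (nrm (A \<tau>))"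
    unfolding recovery_error_def by (intro SUP_least) (auto intro: upper)
  then have eq: "recovery_error nrm A W I U \<Phi> = ereal (nrm (A \<tau>))"
    using lower[OF \<Phi>] by (rule antisym)
  have "optimal_error Y nrm A W I U \<le> recovery_error nrm A W I U \<Phi>"
    unfolding optimal_error_def using \<Phi> by (intro INF_lower) simp
  moreover have "ereal (nrm (A \<tau>)) \<le> optimal_error Y nrm A W I U"
    unfolding optimal_error_def using lower by (intro INF_greatest) simp
  ultimately have "optimal_error Y nrm A W I U = recovery_error nrm A W I U \<Phi>"
    using eq by (intro antisym) simp_all
  then show ?thesis using \<Phi> eq by (simp add: optimal_method_def)
qed

text \<open>At each node \<open>tau\<close> lies between 0 and \<open>e $ j\<close>. Both signs are
  wanted so that zero information can arise from \<open>\<tau>\<close> and from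
  \<open>-\<tau>\<close>.\<close>

lemma info_tau_in_error_box:
  assumes "modulus_of_continuity \<omega>" "range q \<subseteq> K" "\<And>j. 0 \<le> e $ j"
  shows "info q (tau \<omega> K q e) \<in> error_box e" "- info q (tau \<omega> K q e) \<in> error_box e"
proof -
  have "0 \<le> tau \<omega> K q e (q j) \<and> tau \<omega> K q e (q j) \<le> e $ j \<and> 0 \<le> e $ j" for j
    using tau_nonneg[OF assms(1,3)] tau_at_node_le[OF assms(1,2)] assms(3) by blast
  then have "\<bar>tau \<omega> K q e (q j)\<bar> \<le> e $ j" for j by (simp add: abs_le_iff)
  then show "info q (tau \<omega> K q e) \<in> error_box e" "- info q (tau \<omega> K q e) \<in> error_box e"
    by (simp_all add: info_def error_box_def abs_le_iff minus_le_iff)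
qed

theorem corollary8:
  fixes d :: nat and N M1 :: "(real \<times> real) set" and M2 M3 :: "real set"
    and \<omega>1 \<omega>2 \<omega>3 :: "real \<Rightarrow> real"
    and q1 :: "'n1::{finite,linorder} \<Rightarrow> real \<times> real"
    and q2 :: "'n2::{finite,linorder} \<Rightarrow> real"
    and q3 :: "'n3::{finite,linorder} \<Rightarrow> real"
    and e1 :: "real ^ 'n1::{finite,linorder}" and e2 :: "real ^ 'n2::{finite,linorder}" and e3 :: "real ^ 'n3::{finite,linorder}"
    and Y :: "(real \<times> real \<Rightarrow> real) set" and nrm :: "(real \<times> real \<Rightarrow> real) \<Rightarrow> real"
  defines "\<mu>N \<equiv> manifold_measure d N"
    and "W \<equiv> H_class upper_half_plane \<omega>1 M1 \<times> H_class UNIV \<omega>2 M2 \<times> H_class UNIV \<omega>3 M3"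
    and "I \<equiv> (\<lambda>(f, g, h). (info q1 f, info q2 g, info q3 h))"
    and "U \<equiv> error_box e1 \<times> error_box e2 \<times> error_box e3"
    and "L \<equiv> (\<lambda>(z1, z2, z3). (L_op \<omega>1 M1 q1 e1 z1, L_op \<omega>2 M2 q2 e2 z2, L_op \<omega>3 M3 q3 e3 z3))"
    and "\<tau> \<equiv> (tau \<omega>1 M1 q1 e1, tau \<omega>2 M2 q2 e2, tau \<omega>3 M3 q3 e3)"
  assumes "N \<subseteq> upper_half_plane" and "submanifold d N"
    and "compact M1" and "M1 \<subseteq> upper_half_plane" and "compact M2" and "compact M3"
    and "modulus_of_continuity \<omega>1" and "modulus_of_continuity \<omega>2" and "modulus_of_continuity \<omega>3"
    and "inj q1" and "range q1 \<subseteq> M1"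
    and "inj q2" and "range q2 \<subseteq> M2"
    and "inj q3" and "range q3 \<subseteq> M3"
    and "\<And>j. 0 \<le> e1 $ j" and "\<And>j. 0 \<le> e2 $ j" and "\<And>j. 0 \<le> e3 $ j"
    and "normed_lattice \<mu>N Y nrm"
    and "\<And>x. integrable \<mu>N x \<Longrightarrow> (\<exists>C. AE p in \<mu>N. \<bar>x p\<bar> \<le> C) \<Longrightarrow> x \<in> Y"
    and "wave1 ` bounded_borel M1 \<subseteq> Y"
    and "wave2 ` bounded_borel M2 \<subseteq> Y"
    and "wave3 ` bounded_borel M3 \<subseteq> Y"
  shows "optimal_method Y nrm wave W I U (\<lambda>z. wave (L z)) \<and>
    optimal_error Y nrm wave W I U = recovery_error nrm wave W I U (\<lambda>z. wave (L z)) \<and>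
    recovery_error nrm wave W I U (\<lambda>z. wave (L z)) = ereal (nrm (wave \<tau>))"
proof -
  have nl: "normed_lattice \<mu>N Y nrm" by fact
  have \<omega>: "modulus_of_continuity \<omega>1" "modulus_of_continuity \<omega>2" "modulus_of_continuity \<omega>3" by fact+
  have K: "compact M1" "compact M2" "compact M3" by fact+
  have q: "range q1 \<subseteq> M1" "range q2 \<subseteq> M2" "range q3 \<subseteq> M3" by fact+
  \<comment> \<open>The integral estimates are stated for bounded Borel functions on the whole
    space; this forgets the supports \<open>M1\<close>, \<open>M2\<close>,
    \<open>M3\<close>.\<close>
  note UNIV_I' = subsetD[OF bounded_borel_mono[OF subset_UNIV]]
  \<comment> \<open>The three image assumptions put each summand into \<open>Y\<close>, which is
    closed under sums.\<close>
  have wave_Y: "wave (f, g, h) \<in> Y"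
    if "f \<in> bounded_borel M1" "g \<in> bounded_borel M2" "h \<in> bounded_borel M3" for f g h
  proof -
    have "wave1 f \<in> Y" "wave2 g \<in> Y" "wave3 h \<in> Y"
      using that \<open>wave1 ` _ \<subseteq> Y\<close> \<open>wave2 ` _ \<subseteq> Y\<close> \<open>wave3 ` _ \<subseteq> Y\<close> by auto
    then show ?thesis by (simp add: wave_def normed_lattice_add(1)[OF nl])
  qed
  have bbH: "f \<in> bounded_borel M1 \<and> g \<in> bounded_borel M2 \<and> h \<in> bounded_borel M3"
    if "(f, g, h) \<in> W" for f g h
    using that K \<open>M1 \<subseteq> upper_half_plane\<close> by (auto simp: W_def intro: bounded_borel_H_class)
  have bbL: "L_op \<omega>1 M1 q1 e1 z1 \<in> bounded_borel M1" "L_op \<omega>2 M2 q2 e2 z2 \<in> bounded_borel M2"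
    "L_op \<omega>3 M3 q3 e3 z3 \<in> bounded_borel M3" for z1 z2 z3
    using \<omega> K by (auto intro: bounded_borel_L_op compact_imp_closed)
  have \<tau>W: "\<tau> \<in> W" using \<omega> by (simp add: \<tau>_def W_def tau_in_H_class)
  note bb\<tau> = bbH[OF \<tau>W[unfolded \<tau>_def]]
  define \<sigma> where "\<sigma> = (\<lambda>p. - tau \<omega>1 M1 q1 e1 p, \<lambda>v. - tau \<omega>2 M2 q2 e2 v, \<lambda>v. - tau \<omega>3 M3 q3 e3 v)"
  have box: "info q1 (tau \<omega>1 M1 q1 e1) \<in> error_box e1" "- info q1 (tau \<omega>1 M1 q1 e1) \<in> error_box e1"
    "info q2 (tau \<omega>2 M2 q2 e2) \<in> error_box e2" "- info q2 (tau \<omega>2 M2 q2 e2) \<in> error_box e2"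
    "info q3 (tau \<omega>3 M3 q3 e3) \<in> error_box e3" "- info q3 (tau \<omega>3 M3 q3 e3) \<in> error_box e3"
    using \<omega> q \<open>\<And>j. 0 \<le> e1 $ j\<close> \<open>\<And>j. 0 \<le> e2 $ j\<close> \<open>\<And>j. 0 \<le> e3 $ j\<close>
    by (simp_all add: info_tau_in_error_box)
  have "- I \<tau> \<in> U" "I \<tau> \<in> U" using box by (simp_all add: I_def \<tau>_def U_def)
  have "I \<sigma> = - I \<tau>" by (simp add: I_def \<sigma>_def \<tau>_def info_def vec_eq_iff)
  show ?thesis
  \<comment> \<open>Zero is the common information:
    \<open>0 = I \<tau> + (- I \<tau>) = I \<sigma> + I \<tau>\<close>.\<close>
  proof (rule optimal_method_if_symmetric_witness[OF nl, where \<sigma> = \<sigma> and z = 0])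
    show "range (\<lambda>z. wave (L z)) \<subseteq> Y" using wave_Y bbL by (auto simp: L_def)
    show "\<tau> \<in> W" by fact
    show "wave \<tau> \<in> Y" using bb\<tau> by (simp add: \<tau>_def wave_Y)
    show "\<sigma> \<in> W" using \<tau>W by (simp add: \<sigma>_def \<tau>_def W_def H_class_uminus)
    show "wave \<sigma> p = - wave \<tau> p" for p by (simp add: \<sigma>_def \<tau>_def wave_uminus)
    show "0 \<in> {I \<tau> + u | u. u \<in> U}" using \<open>- I \<tau> \<in> U\<close> by (intro CollectI exI[of _ "- I \<tau>"]) simp
    show "0 \<in> {I \<sigma> + u | u. u \<in> U}" using \<open>I \<tau> \<in> U\<close> \<open>I \<sigma> = - I \<tau>\<close> by (intro CollectI exI[of _ "I \<tau>"]) simp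
  next
    fix x u assume x: "x \<in> W" and u: "u \<in> U"
    obtain f g h where fgh: "x = (f, g, h)" by (cases x)
    obtain u1 u2 u3 where u123: "u = (u1, u2, u3)" by (cases u)
    have L: "L (I x + u) = (L_op \<omega>1 M1 q1 e1 (info q1 f + u1), L_op \<omega>2 M2 q2 e2 (info q2 g + u2),
        L_op \<omega>3 M3 q3 e3 (info q3 h + u3))"
      by (simp add: L_def I_def fgh u123)
    \<comment> \<open>The componentwise bounds of \<open>L_op_error\<close> pass through
      \<open>wave\<close>. The estimate holds at every point, hence almost everywhere on
      \<open>N\<close> in any dimension.\<close>
    have "\<bar>wave x p - wave (L (I x + u)) p\<bar> \<le> wave \<tau> p" for p
      unfolding L unfolding fgh \<tau>_def
      using bbH[OF x[unfolded fgh]] bbL bb\<tau> x u \<omega> q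
      by (intro wave_diff_le) (auto simp: fgh u123 W_def U_def intro: UNIV_I' L_op_error)
    \<comment> \<open>The norm is monotone only within \<open>Y\<close>, so the error function must
      be shown to belong to it.\<close>
    moreover have "(\<lambda>p. wave x p - wave (L (I x + u)) p) \<in> Y"
      unfolding L unfolding fgh using bbH[OF x[unfolded fgh]] bbL
      by (intro normed_lattice_diff[OF nl] wave_Y) auto
    ultimately show "nrm (\<lambda>p. wave x p - wave (L (I x + u)) p) \<le> nrm (wave \<tau>)"
      using bb\<tau> by (intro normed_lattice_abs_le[OF nl]) (auto simp: \<tau>_def wave_Y)
  qed
qed

end
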